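(* Let $\sigma$ be a connected skew shape with height $a$ and width $b$. Let $\mu$ be any toggle-symmetric probability distribution on the set $\mathcal{J}(\sigma)$ of subshapes of $\sigma$. Then the expected jaggedness of a subshape of $\sigma$ with respect to $\mu$ is $$\mathbb{E}_\mu(\mathrm{jag}) = \frac{2ab}{a+b}\left( 1 + \sum_{c\in C(\sigma)} \delta(c)\,\mathbb{P}_\mu(c)\right),$$ where $C(\sigma)$ is the set of outward corners of $\sigma$, $\delta(c)$ is the displacement of $c$, and $\mathbb{P}_\mu(c)$ is the probability that the lattice path of a $\mu$-random subshape includes both steps of the corner $c$.
   Context: Skew shapes. For partitions $\nu\subseteq\lambda$ (i.e. $\nu_i\le\lambda_i$ for all $i$), the skew shape $\sigma=\lambda/\nu$ is the diagram obtained by removing the Young diagram of $\nu$ from that of $\lambda$ (English notation). Its height $a$ is its number of rows and its width $b$ its number of columns. Place $\sigma$ in an $a\times b$ rectangle with coordinates (row coordinate increasing downward, column coordinate increasing rightward) so that the northwest corner of the rectangle is $(0,0)$ and the southeast corner is $(a,b)$. Write $[i,j]$ for the unit box whose southeast corner is $(i,j)$. The poset $P_\sigma$ has as elements the boxes of $\sigma$, with $[i,j]\le[k,l]$ iff $i\le k$ and $j\le l$. The shape $\sigma$ is connected if $P_\sigma$ is a connected (in particular nonempty) poset. Subshapes. A subshape of $\sigma=\lambda/\nu$ is a skew shape $\rho/\nu$ with $\rho$ a partition, $\nu\subseteq\rho\subseteq\lambda$; subshapes are exactly the order ideals (down-closed subsets) of $P_\sigma$. Their set is $\mathcal{J}(\sigma)=\mathcal{J}(P_\sigma)$.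 A subshape $\rho/\nu$ is identified with its lattice path: the sequence of steps $(-1,0)$ and $(0,1)$ from $(a,0)$ to $(0,b)$ given by the southeast border of $\rho$. Jaggedness and toggle-symmetry. For a finite poset $P$, an order ideal $I$ and $p\in P$: $p$ can be toggled in to $I$ if $p$ is a minimal element of $P\setminus I$, and $p$ can be toggled out of $I$ if $p$ is a maximal element of $I$. The jaggedness $\mathrm{jag}(I)$ is the total number of elements $p\in P$ that can be toggled in to $I$ or out of $I$. A probability distribution $\mu$ on $\mathcal{J}(P)$ is toggle-symmetric if for every $p\in P$, $\mathbb{P}_\mu(p\text{ can be toggled in to }I)=\mathbb{P}_\mu(p\text{ can be toggled out of }I)$. Outward corners. For connected $\sigma$, an outward corner of $\sigma$ is a pair of consecutive steps along the boundary of $\sigma$ that do not belong to the same line and do not border a common box of $\sigma$; it occurs at the lattice point $(i,j)$ where its two steps meet. Each outward corner is either a northwest corner (part of the northwest border of $\sigma$: $[i,j]\notin\sigma$ while $[i+1,j],[i,j+1]\in\sigma$) or a southeast corner (part of the southeast border: $[i+1,j+1]\notin\sigma$ while $[i+1,j],[i,j+1]\in\sigma$). $C(\sigma)$ denotes the set of outward corners. $\mathbb{P}_\mu(c)$ is the $\mu$-probability that the lattice path of the subshape includes both steps of $c$ (this is stronger than passing through the point $(i,j)$). Displacement. For an outward corner $c$ occurring at $(i,j)$, $\delta(c)=1-\frac{i}{a}-\frac{j}{b}$ if $c$ is a northwest corner, and $\delta(c)=-1+\frac{i}{a}+\frac{j}{b}$ if $c$ is a southeast corner. *)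

theory Defs
  imports "HOL-Probability.Probability_Mass_Function" "HOL-Library.Product_Order"
begin

section \<open>Order ideals, toggles, jaggedness\<close>

text \<open>A finite poset is a finite set \<open>P\<close> in a type of class \<^class>\<open>order\<close>.\<close>

definition order_ideals :: "'a::order set \<Rightarrow> 'a set set" where
  "order_ideals P = {I. I \<subseteq> P \<and> (\<forall>p\<in>I. \<forall>q\<in>P. q \<le> p \<longrightarrow> q \<in> I)}"

definition connected_poset :: "'a::order set \<Rightarrow> bool" where
  "connected_poset P \<longleftrightarrow> P \<noteq> {} \<and>
     (\<forall>p\<in>P. \<forall>q\<in>P. (p, q) \<in> {(x, y). x \<in> P \<and> y \<in> P \<and> (x \<le> y \<or> y \<le> x)}\<^sup>*)"

definition can_toggle_in :: "'a::order set \<Rightarrow> 'a \<Rightarrow> 'a set \<Rightarrow> bool" where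
  "can_toggle_in P p I \<longleftrightarrow> p \<in> P - I \<and> (\<forall>q\<in>P - I. q \<le> p \<longrightarrow> q = p)"

definition can_toggle_out :: "'a::order set \<Rightarrow> 'a \<Rightarrow> 'a set \<Rightarrow> bool" where
  "can_toggle_out P p I \<longleftrightarrow> p \<in> P \<and> p \<in> I \<and> (\<forall>q\<in>I. p \<le> q \<longrightarrow> q = p)"

definition jag :: "'a::order set \<Rightarrow> 'a set \<Rightarrow> nat" where
  "jag P I = card {p \<in> P. can_toggle_in P p I \<or> can_toggle_out P p I}"

definition toggle_symmetric :: "'a::order set \<Rightarrow> 'a set pmf \<Rightarrow> bool" where
  "toggle_symmetric P \<mu> \<longleftrightarrow> (\<forall>p\<in>P.
     measure_pmf.prob \<mu> {I. can_toggle_in P p I} = measure_pmf.prob \<mu> {I. can_toggle_out P p I})"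


section \<open>Skew shapes\<close>

text \<open>The part \<open>\<lambda>\<^sub>i\<close> (\<open>i \<ge> 1\<close>) of a partition is the value of the function at \<open>i - 1\<close>.\<close>

type_synonym partition = "nat \<Rightarrow> nat"
type_synonym skew = "partition \<times> partition"
type_synonym box = "nat \<times> nat"
type_synonym point = "nat \<times> nat"
type_synonym step = "point \<times> point"

definition is_partition :: "partition \<Rightarrow> bool" where
  "is_partition p \<longleftrightarrow> antimono p \<and> finite {i. p i \<noteq> 0}"

definition skew_shape :: "skew \<Rightarrow> bool" where
  "skew_shape = (\<lambda>(lam, nu). is_partition lam \<and> is_partition nu \<and> nu \<le> lam)"

text \<open>Boxes of \<open>\<lambda>/\<nu>\<close> in the coordinates of the Young diagram of \<open>\<lambda>\<close>, named by their southeast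
  corners, so both coordinates of a box are at least 1.\<close>

definition diagram :: "skew \<Rightarrow> box set" where
  "diagram = (\<lambda>(lam, nu). {(Suc i, j) | i j. nu i < j \<and> j \<le> lam i})"

definition height :: "skew \<Rightarrow> nat" where
  "height \<sigma> = card (fst ` diagram \<sigma>)"

definition width :: "skew \<Rightarrow> nat" where
  "width \<sigma> = card (snd ` diagram \<sigma>)"

text \<open>The first rows and columns of \<open>\<lambda>/\<nu>\<close> may be empty; in a connected shape the nonempty ones are
  consecutive. The \<open>a \<times> b\<close> rectangle containing the shape starts after the first
  \<open>row_offset\<close> rows and \<open>col_offset\<close> columns.\<close>

definition row_offset :: "skew \<Rightarrow> nat" where
  "row_offset \<sigma> = Min (fst ` diagram \<sigma>) - 1"

definition col_offset :: "skew \<Rightarrow> nat" where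
  "col_offset \<sigma> = Min (snd ` diagram \<sigma>) - 1"

definition place :: "skew \<Rightarrow> box set \<Rightarrow> box set" where
  "place \<sigma> B = (\<lambda>(i, j). (i - row_offset \<sigma>, j - col_offset \<sigma>)) ` B"

text \<open>The set of boxes of \<open>\<sigma>\<close> in rectangle coordinates; it carries the componentwise order of
  \<^theory>\<open>HOL-Library.Product_Order\<close>.\<close>

definition boxes :: "skew \<Rightarrow> box set" where
  "boxes \<sigma> = place \<sigma> (diagram \<sigma>)"

definition connected_skew :: "skew \<Rightarrow> bool" where
  "connected_skew \<sigma> \<longleftrightarrow> connected_poset (boxes \<sigma>)"


section \<open>Subshapes and their lattice paths\<close>

definition valid_outer :: "skew \<Rightarrow> partition \<Rightarrow> bool" where
  "valid_outer \<sigma> rho \<longleftrightarrow> is_partition rho \<and> snd \<sigma> \<le> rho \<and> rho \<le> fst \<sigma>"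

definition subshape :: "skew \<Rightarrow> partition \<Rightarrow> box set" where
  "subshape \<sigma> rho = place \<sigma> (diagram (rho, snd \<sigma>))"

definition subshapes :: "skew \<Rightarrow> box set set" where
  "subshapes \<sigma> = {subshape \<sigma> rho | rho. valid_outer \<sigma> rho}"

text \<open>The partition \<open>\<rho>\<close> of a subshape \<open>\<rho>/\<nu>\<close>; see \<open>outer_subshape\<close> below.\<close>

definition outer :: "skew \<Rightarrow> box set \<Rightarrow> partition" where
  "outer \<sigma> I = (THE rho. valid_outer \<sigma> rho \<and> subshape \<sigma> rho = I)"

text \<open>Row \<open>i\<close> of the rectangle (\<open>1 \<le> i \<le> a\<close>) contains \<open>row_end \<sigma> \<rho> i\<close> boxes of the Young diagram of
  \<open>\<rho>\<close>. The values at \<open>0\<close> and from \<open>a + 1\<close> on encode that the path ends at \<open>(0, b)\<close> and starts at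
  \<open>(a, 0)\<close>.\<close>

definition row_end :: "skew \<Rightarrow> partition \<Rightarrow> nat \<Rightarrow> nat" where
  "row_end \<sigma> rho i =
     (if i = 0 then width \<sigma>
      else if i \<le> height \<sigma> then rho (row_offset \<sigma> + i - 1) - col_offset \<sigma>
      else 0)"

text \<open>The points of the southeast border of \<open>\<rho>\<close> in order from \<open>(a, 0)\<close> to \<open>(0, b)\<close>: on the
  horizontal line with row coordinate \<open>i\<close>, between rows \<open>i\<close> and \<open>i + 1\<close>, the path visits the points
  with column coordinates from the end of row \<open>i + 1\<close> to the end of row \<open>i\<close>.\<close>

definition border_points :: "skew \<Rightarrow> partition \<Rightarrow> point list" where
  "border_points \<sigma> rho =
     concat (map (\<lambda>i. map (Pair i) [row_end \<sigma> rho (Suc i) ..< Suc (row_end \<sigma> rho i)])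
                 (rev [0 ..< Suc (height \<sigma>)]))"

definition lattice_path :: "skew \<Rightarrow> box set \<Rightarrow> step list" where
  "lattice_path \<sigma> I = (let ps = border_points \<sigma> (outer \<sigma> I) in zip ps (tl ps))"


section \<open>Outward corners\<close>

definition vertical_step :: "step \<Rightarrow> bool" where
  "vertical_step = (\<lambda>((i, j), (i', j')). i = Suc i' \<and> j' = j)"

definition horizontal_step :: "step \<Rightarrow> bool" where
  "horizontal_step = (\<lambda>((i, j), (i', j')). i' = i \<and> j' = Suc j)"

text \<open>A step borders a box if it is one of the four sides of the box.\<close>

definition borders :: "step \<Rightarrow> box \<Rightarrow> bool" where
  "borders = (\<lambda>(p, q) (i, j). {p, q} \<subseteq> {i - 1, i} \<times> {j - 1, j})"

text \<open>The northwest and the southeast border of a connected shape are both traversed from \<open>(a, 0)\<close>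
  to \<open>(0, b)\<close>.\<close>

definition boundary_step :: "skew \<Rightarrow> step \<Rightarrow> bool" where
  "boundary_step \<sigma> s \<longleftrightarrow> (vertical_step s \<or> horizontal_step s) \<and> (\<exists>!B. B \<in> boxes \<sigma> \<and> borders s B)"

text \<open>Two steps of the boundary meeting at the start or at the end of both (at \<open>(a, 0)\<close> or at
  \<open>(0, b)\<close>) border a common box of \<open>\<sigma>\<close>, so it suffices to consider steps meeting head to tail.\<close>

definition outward_corners :: "skew \<Rightarrow> (step \<times> step) set" where
  "outward_corners \<sigma> = {(s, t). boundary_step \<sigma> s \<and> boundary_step \<sigma> t \<and> snd s = fst t \<and>
     vertical_step s \<noteq> vertical_step t \<and> \<not> (\<exists>B\<in>boxes \<sigma>. borders s B \<and> borders t B)}"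

definition corner_point :: "step \<times> step \<Rightarrow> point" where
  "corner_point c = snd (fst c)"

definition northwest_at :: "skew \<Rightarrow> point \<Rightarrow> bool" where
  "northwest_at \<sigma> = (\<lambda>(i, j). (i, j) \<notin> boxes \<sigma> \<and> (i + 1, j) \<in> boxes \<sigma> \<and> (i, j + 1) \<in> boxes \<sigma>)"

definition southeast_at :: "skew \<Rightarrow> point \<Rightarrow> bool" where
  "southeast_at \<sigma> = (\<lambda>(i, j). (i + 1, j + 1) \<notin> boxes \<sigma> \<and> (i + 1, j) \<in> boxes \<sigma> \<and> (i, j + 1) \<in> boxes \<sigma>)"

text \<open>By \<open>outward_corner_cases\<close> and \<open>not_northwest_and_southeast\<close> below, the second alternative is
  the case of a southeast corner.\<close>

definition displacement :: "skew \<Rightarrow> step \<times> step \<Rightarrow> real" where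
  "displacement \<sigma> c = (let (i, j) = corner_point c; a = height \<sigma>; b = width \<sigma> in
     if northwest_at \<sigma> (i, j) then 1 - real i / real a - real j / real b
     else - 1 + real i / real a + real j / real b)"

definition corner_prob :: "skew \<Rightarrow> box set pmf \<Rightarrow> step \<times> step \<Rightarrow> real" where
  "corner_prob \<sigma> \<mu> c = measure_pmf.prob \<mu>
     {I. fst c \<in> set (lattice_path \<sigma> I) \<and> snd c \<in> set (lattice_path \<sigma> I)}"


section \<open>Well-definedness\<close>

lemma mem_diagram: "(k, j) \<in> diagram (lam, nu) \<longleftrightarrow> 1 \<le> k \<and> nu (k - 1) < j \<and> j \<le> lam (k - 1)"
  unfolding diagram_def by (cases k) auto

lemma finite_diagram:
  assumes "skew_shape \<sigma>" shows "finite (diagram \<sigma>)"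
proof -
  obtain lam nu where s: "\<sigma> = (lam, nu)" by force
  have f: "finite {i. lam i \<noteq> 0}" and am: "antimono lam"
    using assms by (auto simp: s skew_shape_def is_partition_def)
  have "diagram \<sigma> \<subseteq> Suc ` {i. lam i \<noteq> 0} \<times> {..lam 0}"
  proof
    fix x assume "x \<in> diagram \<sigma>"
    then obtain i j where "x = (Suc i, j)" "nu i < j" "j \<le> lam i" by (auto simp: s diagram_def)
    moreover have "lam i \<le> lam 0" by (intro antimonoD[OF am]) simp
    ultimately show "x \<in> Suc ` {i. lam i \<noteq> 0} \<times> {..lam 0}" by auto
  qed
  then show ?thesis
    using f by (meson finite_SigmaI finite_atMost finite_imageI finite_subset)
qed

lemma offset_less:
  assumes "skew_shape \<sigma>" "(k, j) \<in> diagram \<sigma>"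
  shows "row_offset \<sigma> < k" "col_offset \<sigma> < j"
proof -
  have f: "finite (diagram \<sigma>)" using finite_diagram assms by blast
  have "Min (fst ` diagram \<sigma>) \<le> k" "Min (snd ` diagram \<sigma>) \<le> j"
    using f assms(2) by (force intro!: Min_le)+
  moreover have "k \<ge> 1" "j \<ge> 1" using assms(2) by (auto simp: diagram_def split: prod.splits)
  ultimately show "row_offset \<sigma> < k" "col_offset \<sigma> < j"
    unfolding row_offset_def col_offset_def by linarith+
qed

lemma mem_place:
  assumes "skew_shape \<sigma>" "B \<subseteq> diagram \<sigma>"
  shows "(i, j) \<in> place \<sigma> B \<longleftrightarrow>
    1 \<le> i \<and> 1 \<le> j \<and> (i + row_offset \<sigma>, j + col_offset \<sigma>) \<in> B"
proof
  assume "(i, j) \<in> place \<sigma> B"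
  then obtain k l where kl: "(k, l) \<in> B" "i = k - row_offset \<sigma>" "j = l - col_offset \<sigma>"
    by (auto simp: place_def)
  then have "row_offset \<sigma> < k" "col_offset \<sigma> < l" using offset_less assms by blast+
  then show "1 \<le> i \<and> 1 \<le> j \<and> (i + row_offset \<sigma>, j + col_offset \<sigma>) \<in> B" using kl by auto
next
  assume "1 \<le> i \<and> 1 \<le> j \<and> (i + row_offset \<sigma>, j + col_offset \<sigma>) \<in> B"
  then show "(i, j) \<in> place \<sigma> B" unfolding place_def by force
qed

lemma place_inj:
  assumes "skew_shape \<sigma>" "B \<subseteq> diagram \<sigma>" "B' \<subseteq> diagram \<sigma>" "place \<sigma> B = place \<sigma> B'"
  shows "B = B'"
proof -
  have "x \<in> C'" if "C \<subseteq> diagram \<sigma>" "C' \<subseteq> diagram \<sigma>" "place \<sigma> C = place \<sigma> C'" "x \<in> C" for C C' x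
  proof -
    obtain k l where x: "x = (k, l)" by force
    have *: "row_offset \<sigma> < k" "col_offset \<sigma> < l" using offset_less assms(1) that x by blast+
    have "(k - row_offset \<sigma>, l - col_offset \<sigma>) \<in> place \<sigma> C" using that(4) x by (force simp: place_def)
    then show ?thesis
      using * that(3) mem_place[OF assms(1) that(2)] x by auto
  qed
  then show ?thesis using assms by blast
qed

lemma diagram_subset:
  assumes "valid_outer \<sigma> rho" shows "diagram (rho, snd \<sigma>) \<subseteq> diagram \<sigma>"
proof -
  obtain lam nu where s: "\<sigma> = (lam, nu)" by force
  have "rho i \<le> lam i" for i using assms by (auto simp: s valid_outer_def le_fun_def)
  then have "j \<le> lam i" if "j \<le> rho i" for i j using that le_trans by blast
  then show ?thesis by (auto simp: s diagram_def)
qed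

lemma outer_subshape:
  assumes "skew_shape \<sigma>" "valid_outer \<sigma> rho"
  shows "outer \<sigma> (subshape \<sigma> rho) = rho"
proof -
  obtain lam nu where s: "\<sigma> = (lam, nu)" by force
  have sub: "diagram (r, nu) \<subseteq> diagram \<sigma>" if "valid_outer \<sigma> r" for r
    using diagram_subset[OF that] by (simp add: s)
  have le: "r i \<le> r' i"
    if b: "valid_outer \<sigma> r" "valid_outer \<sigma> r'" "subshape \<sigma> r = subshape \<sigma> r'" for r r' i
  proof (rule ccontr)
    assume n: "\<not> r i \<le> r' i"
    have d: "diagram (r, nu) = diagram (r', nu)"
      using place_inj[OF assms(1) sub[OF b(1)] sub[OF b(2)]] b(3) by (simp add: s subshape_def)
    have "nu i \<le> r' i" using b(2) by (auto simp: s valid_outer_def le_fun_def)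
    then have "(Suc i, r i) \<in> diagram (r, nu)" using n by (simp add: mem_diagram)
    then show False using n by (simp add: d mem_diagram)
  qed
  show ?thesis unfolding outer_def
  proof (rule the_equality)
    fix r assume "valid_outer \<sigma> r \<and> subshape \<sigma> r = subshape \<sigma> rho"
    then show "r = rho" using le assms(2) by (metis antisym ext)
  qed (use assms in auto)
qed

lemma subshapes_eq_order_ideals:
  assumes "skew_shape \<sigma>"
  shows "subshapes \<sigma> = order_ideals (boxes \<sigma>)"
proof -
  obtain lam nu where s: "\<sigma> = (lam, nu)" by force
  have ss: "antimono lam" "antimono nu" "nu \<le> lam" "finite {i. lam i \<noteq> 0}"
    using assms by (auto simp: s skew_shape_def is_partition_def)
  have sub: "diagram (r, nu) \<subseteq> diagram \<sigma>" if "valid_outer \<sigma> r" for r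
    using diagram_subset[OF that] by (simp add: s)
  have "subshape \<sigma> r \<in> order_ideals (boxes \<sigma>)" if b: "valid_outer \<sigma> r" for r
  proof -
    have r: "antimono r" using b by (simp add: valid_outer_def is_partition_def)
    have "q \<in> subshape \<sigma> r" if "p \<in> subshape \<sigma> r" "q \<in> boxes \<sigma>" "q \<le> p" for p q
    proof -
      obtain i j k l where pq: "p = (i, j)" "q = (k, l)" by force
      have kl: "k \<le> i" "l \<le> j" using that(3) by (auto simp: pq)
      have p: "1 \<le> i" "1 \<le> j" "(i + row_offset \<sigma>, j + col_offset \<sigma>) \<in> diagram (r, nu)"
        using that(1) mem_place[OF assms sub[OF b]] by (auto simp: subshape_def pq s)
      have q: "1 \<le> k" "1 \<le> l" "(k + row_offset \<sigma>, l + col_offset \<sigma>) \<in> diagram (lam, nu)"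
        using that(2) mem_place[OF assms order_refl] by (auto simp: boxes_def pq s)
      have "r (i + row_offset \<sigma> - 1) \<le> r (k + row_offset \<sigma> - 1)"
        using kl by (intro antimonoD[OF r]) simp
      then have "(k + row_offset \<sigma>, l + col_offset \<sigma>) \<in> diagram (r, nu)"
        using p q kl by (simp add: mem_diagram)
      then show ?thesis
        using q mem_place[OF assms sub[OF b]] by (auto simp: subshape_def pq s)
    qed
    moreover have "subshape \<sigma> r \<subseteq> boxes \<sigma>"
      using sub[OF b] by (auto simp: subshape_def boxes_def place_def s)
    ultimately show ?thesis by (auto simp: order_ideals_def)
  qed
  moreover have "I \<in> subshapes \<sigma>" if I: "I \<in> order_ideals (boxes \<sigma>)" for I
  proof -
    define D where "D = {x \<in> diagram \<sigma>. (\<lambda>(i, j). (i - row_offset \<sigma>, j - col_offset \<sigma>)) x \<in> I}"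
    have ID: "I = place \<sigma> D"
      using I by (auto simp: order_ideals_def boxes_def place_def D_def)
    have down: "y \<in> D" if "x \<in> D" "y \<in> diagram \<sigma>" "y \<le> x" for x y
    proof -
      have "(\<lambda>(i, j). (i - row_offset \<sigma>, j - col_offset \<sigma>)) y \<in> boxes \<sigma>"
        using that(2) by (auto simp: boxes_def place_def)
      moreover have "(\<lambda>(i, j). (i - row_offset \<sigma>, j - col_offset \<sigma>)) y
          \<le> (\<lambda>(i, j). (i - row_offset \<sigma>, j - col_offset \<sigma>)) x"
        using that(3) by (auto simp: less_eq_prod_def split: prod.splits intro: diff_le_mono)
      ultimately show ?thesis
        using I that(1,2) unfolding order_ideals_def D_def by blast
    qed
    define R where "R i = {j. (Suc i, j) \<in> D}" for i
    define rho where "rho i = Max (insert (nu i) (R i))" for i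
    have Rlam: "j \<le> lam i \<and> nu i < j" if "j \<in> R i" for i j
      using that by (auto simp: R_def D_def s mem_diagram)
    have finR: "finite (R i)" for i
      by (rule finite_subset[of _ "{..lam i}"]) (use Rlam in auto)
    have rho_ge: "nu i \<le> rho i" for i using finR by (simp add: rho_def)
    have rho_ub: "j \<le> rho i" if "j \<in> R i" for i j using finR that by (simp add: rho_def)
    have rho_in: "rho i \<in> insert (nu i) (R i)" for i unfolding rho_def using finR by (intro Max_in) auto
    have rho_le: "rho i \<le> lam i" for i
      using rho_in[of i] Rlam[of "rho i" i] ss(3) by (auto simp: le_fun_def)
    have step: "rho k \<le> rho i" if "i \<le> k" for i k
    proof (rule ccontr)
      assume n: "\<not> rho k \<le> rho i"
      have "nu k \<le> nu i" "lam k \<le> lam i" using antimonoD ss that by blast+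
      moreover have "rho k \<noteq> nu k" using n rho_ge[of i] \<open>nu k \<le> nu i\<close> by linarith
      ultimately have k: "rho k \<in> R k" "nu i < rho k" "rho k \<le> lam i"
        using rho_in[of k] rho_le[of k] rho_ge[of i] n by auto
      have "(Suc i, rho k) \<in> D"
        by (insert k that, rule down[of "(Suc k, rho k)"]) (auto simp: R_def s mem_diagram)
      then show False using rho_ub[of "rho k" i] n by (auto simp: R_def)
    qed
    have "finite {i. rho i \<noteq> 0}"
      using rho_le by (intro finite_subset[OF _ ss(4)]) (metis (mono_tags, lifting) le_zero_eq mem_Collect_eq subsetI)
    then have b: "valid_outer \<sigma> rho"
      using step rho_ge rho_le by (auto simp: valid_outer_def is_partition_def s le_fun_def antimono_def)
    have "diagram (rho, nu) = D"
    proof (intro set_eqI iffI)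
      fix x assume x: "x \<in> diagram (rho, nu)"
      then obtain i j where ij: "x = (Suc i, j)" "nu i < j" "j \<le> rho i" by (auto simp: diagram_def)
      then have "rho i \<in> R i" using rho_in[of i] by auto
      then have "(Suc i, rho i) \<in> D" by (simp add: R_def)
      moreover have "x \<in> diagram \<sigma>" using sub[OF b] x by blast
      moreover have "x \<le> (Suc i, rho i)" using ij by simp
      ultimately show "x \<in> D" by (rule down)
    next
      fix x assume x: "x \<in> D"
      then have "x \<in> diagram (lam, nu)" by (simp add: D_def s)
      then obtain i j where ij: "x = (Suc i, j)" "nu i < j" by (auto simp: diagram_def)
      then show "x \<in> diagram (rho, nu)" using x rho_ub[of j i] by (auto simp: R_def mem_diagram)
    qed
    then show ?thesis using b ID by (auto simp: subshapes_def subshape_def s)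
  qed
  ultimately show ?thesis by (auto simp: subshapes_def)
qed

lemma boxes_pos: 
  assumes "skew_shape \<sigma>" "(i, j) \<in> boxes \<sigma>" shows "1 \<le> i" "1 \<le> j"
  using assms mem_place[OF assms(1) order_refl] by (auto simp: boxes_def)

lemma finite_boxes: "skew_shape \<sigma> \<Longrightarrow> finite (boxes \<sigma>)"
  by (simp add: boxes_def place_def finite_diagram)

lemma borders_vertical:
  "1 \<le> k \<Longrightarrow> 1 \<le> l \<Longrightarrow> borders ((Suc i, j), (i, j)) (k, l) \<longleftrightarrow> k = Suc i \<and> (l = j \<or> l = Suc j)"
  by (auto simp: borders_def)

lemma borders_horizontal:
  "1 \<le> k \<Longrightarrow> 1 \<le> l \<Longrightarrow> borders ((i, j), (i, Suc j)) (k, l) \<longleftrightarrow> l = Suc j \<and> (k = i \<or> k = Suc i)"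
  by (auto simp: borders_def)

lemma ex1_pair: "x \<noteq> y \<Longrightarrow> (\<exists>!B. B \<in> S \<and> (B = x \<or> B = y)) \<longleftrightarrow> (x \<in> S) \<noteq> (y \<in> S)"
  by metis

lemma boundary_vertical:
  assumes "skew_shape \<sigma>"
  shows "boundary_step \<sigma> ((Suc i, j), (i, j)) \<longleftrightarrow>
    ((Suc i, j) \<in> boxes \<sigma>) \<noteq> ((Suc i, Suc j) \<in> boxes \<sigma>)"
proof -
  have "B \<in> boxes \<sigma> \<and> borders ((Suc i, j), (i, j)) B \<longleftrightarrow>
      B \<in> boxes \<sigma> \<and> (B = (Suc i, j) \<or> B = (Suc i, Suc j))" for B
    using borders_vertical boxes_pos[OF assms] by (cases B) blast
  moreover have "(Suc i, j) \<noteq> (Suc i, Suc j)" by simp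
  note ex1_pair[OF this, of "boxes \<sigma>"]
  ultimately show ?thesis
    unfolding boundary_step_def by (simp only:) (simp add: vertical_step_def)
qed

lemma boundary_horizontal:
  assumes "skew_shape \<sigma>"
  shows "boundary_step \<sigma> ((i, j), (i, Suc j)) \<longleftrightarrow>
    ((i, Suc j) \<in> boxes \<sigma>) \<noteq> ((Suc i, Suc j) \<in> boxes \<sigma>)"
proof -
  have "B \<in> boxes \<sigma> \<and> borders ((i, j), (i, Suc j)) B \<longleftrightarrow>
      B \<in> boxes \<sigma> \<and> (B = (i, Suc j) \<or> B = (Suc i, Suc j))" for B
    using borders_horizontal boxes_pos[OF assms] by (cases B) blast
  moreover have "(i, Suc j) \<noteq> (Suc i, Suc j)" by simp
  note ex1_pair[OF this, of "boxes \<sigma>"]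
  ultimately show ?thesis
    unfolding boundary_step_def by (simp only:) (simp add: horizontal_step_def)
qed

lemma outward_corner_cases:
  assumes "skew_shape \<sigma>"
  shows "outward_corners \<sigma> =
    {(((i, j - 1), (i, j)), ((i, j), (i - 1, j))) | i j. northwest_at \<sigma> (i, j)} \<union>
    {(((i + 1, j), (i, j)), ((i, j), (i, j + 1))) | i j. southeast_at \<sigma> (i, j)}"
    (is "_ = ?NW \<union> ?SE")
proof -
  note pos = boxes_pos[OF assms]
  have common_nw: "(\<exists>B\<in>boxes \<sigma>. borders ((Suc i, j), (Suc i, Suc j)) B
      \<and> borders ((Suc i, Suc j), (i, Suc j)) B) \<longleftrightarrow> (Suc i, Suc j) \<in> boxes \<sigma>" for i j
  proof -
    have "borders ((Suc i, j), (Suc i, Suc j)) B \<and> borders ((Suc i, Suc j), (i, Suc j)) B \<longleftrightarrow> B = (Suc i, Suc j)"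
      if "B \<in> boxes \<sigma>" for B
    proof -
      obtain k l where B: "B = (k, l)" by force
      then have "1 \<le> k" "1 \<le> l" using that pos by blast+
      then show ?thesis by (auto simp: B borders_vertical borders_horizontal)
    qed
    then show ?thesis by blast
  qed
  have common_se: "(\<exists>B\<in>boxes \<sigma>. borders ((Suc i, j), (i, j)) B
      \<and> borders ((i, j), (i, Suc j)) B) \<longleftrightarrow> (Suc i, Suc j) \<in> boxes \<sigma>" for i j
  proof -
    have "borders ((Suc i, j), (i, j)) B \<and> borders ((i, j), (i, Suc j)) B \<longleftrightarrow> B = (Suc i, Suc j)"
      if "B \<in> boxes \<sigma>" for B
    proof -
      obtain k l where B: "B = (k, l)" by force
      then have "1 \<le> k" "1 \<le> l" using that pos by blast+
      then show ?thesis by (auto simp: B borders_vertical borders_horizontal)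
    qed
    then show ?thesis by blast
  qed
  have nw: "(((Suc i, j), (Suc i, Suc j)), ((Suc i, Suc j), (i, Suc j))) \<in> outward_corners \<sigma>
      \<longleftrightarrow> northwest_at \<sigma> (Suc i, Suc j)" for i j
    using common_nw[of i j] boundary_horizontal[OF assms, of "Suc i" j]
      boundary_vertical[OF assms, of i "Suc j"]
    by (auto simp: outward_corners_def northwest_at_def vertical_step_def)
  have se: "(((Suc i, j), (i, j)), ((i, j), (i, Suc j))) \<in> outward_corners \<sigma>
      \<longleftrightarrow> southeast_at \<sigma> (i, j)" for i j
    using common_se[of i j] boundary_horizontal[OF assms, of i j]
      boundary_vertical[OF assms, of i j]
    by (auto simp: outward_corners_def southeast_at_def vertical_step_def)
  show ?thesis
  proof (intro set_eqI iffI)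
    fix c assume c: "c \<in> outward_corners \<sigma>"
    obtain s t where st: "c = (s, t)" by (cases c)
    have k: "vertical_step s \<or> horizontal_step s" "vertical_step t \<or> horizontal_step t"
      "snd s = fst t" "vertical_step s \<noteq> vertical_step t"
      using c by (auto simp: st outward_corners_def boundary_step_def)
    show "c \<in> ?NW \<union> ?SE"
    proof (cases "vertical_step s")
      case True
      then obtain i j where "s = ((Suc i, j), (i, j))" "t = ((i, j), (i, Suc j))"
        using k by (auto simp: vertical_step_def horizontal_step_def split: prod.splits)
      then show ?thesis using c se[of i j] by (auto simp: st)
    next
      case False
      then obtain i j where "s = ((Suc i, j), (Suc i, Suc j))" "t = ((Suc i, Suc j), (i, Suc j))"
        using k by (auto simp: vertical_step_def horizontal_step_def split: prod.splits)
      then show ?thesis using c nw[of i j] by (force simp: st)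
    qed
  next
    fix c assume "c \<in> ?NW \<union> ?SE"
    then show "c \<in> outward_corners \<sigma>"
    proof
      assume "c \<in> ?NW"
      then obtain i j where c: "c = (((i, j - 1), (i, j)), ((i, j), (i - 1, j)))"
        "northwest_at \<sigma> (i, j)" by blast
      then have "1 \<le> i" "1 \<le> j" using pos by (auto simp: northwest_at_def)
      then show ?thesis using c nw[of "i - 1" "j - 1"] by auto
    next
      assume "c \<in> ?SE"
      then show ?thesis using se by auto
    qed
  qed
qed

lemma finite_outward_corners:
  assumes "skew_shape \<sigma>" shows "finite (outward_corners \<sigma>)"
proof -
  have "outward_corners \<sigma> \<subseteq>
      (\<lambda>(k, j). (((k - 1, j - 1), (k - 1, j)), ((k - 1, j), (k - 1 - 1, j)))) ` boxes \<sigma> \<union>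
      (\<lambda>(k, j). (((k, j), (k - 1, j)), ((k - 1, j), (k - 1, j + 1)))) ` boxes \<sigma>"
    unfolding outward_corner_cases[OF assms] northwest_at_def southeast_at_def by force
  then show ?thesis
    using finite_boxes[OF assms] by (meson finite_UnI finite_imageI finite_subset)
qed

lemma not_northwest_and_southeast:
  assumes "skew_shape \<sigma>" "connected_skew \<sigma>"
  shows "\<not> (northwest_at \<sigma> p \<and> southeast_at \<sigma> p)"
proof
  assume h: "northwest_at \<sigma> p \<and> southeast_at \<sigma> p"
  obtain i j where p: "p = (i, j)" by force
  obtain lam nu where s: "\<sigma> = (lam, nu)" by force
  have am: "antimono lam" "antimono nu"
    using assms(1) by (auto simp: s skew_shape_def is_partition_def)
  have mem: "(k, l) \<in> boxes \<sigma> \<longleftrightarrow> 1 \<le> k \<and> 1 \<le> l \<and> nu (k + row_offset \<sigma> - 1) < l + col_offset \<sigma>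
     \<and> l + col_offset \<sigma> \<le> lam (k + row_offset \<sigma> - 1)" for k l
    unfolding boxes_def mem_place[OF assms(1) order_refl] by (auto simp: s mem_diagram)
  have m: "(i, j) \<notin> boxes \<sigma>" "(Suc i, Suc j) \<notin> boxes \<sigma>" "(Suc i, j) \<in> boxes \<sigma>" "(i, Suc j) \<in> boxes \<sigma>"
    using h by (auto simp: p northwest_at_def southeast_at_def)
  have ij: "1 \<le> i" "1 \<le> j" using m boxes_pos[OF assms(1)] by blast+
  have nu_ge: "j + col_offset \<sigma> \<le> nu (i + row_offset \<sigma> - 1)" using m ij unfolding mem by auto
  have lam_le: "lam (Suc i + row_offset \<sigma> - 1) \<le> j + col_offset \<sigma>" using m ij unfolding mem by auto
  have up: "l > j" if "(k, l) \<in> boxes \<sigma>" "k \<le> i" for k l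
  proof -
    have "nu (i + row_offset \<sigma> - 1) \<le> nu (k + row_offset \<sigma> - 1)"
      using that by (intro antimonoD[OF am(2)]) simp
    then show ?thesis using nu_ge that(1) unfolding mem by linarith
  qed
  have low: "l \<le> j" if "(k, l) \<in> boxes \<sigma>" "k > i" for k l
  proof -
    have "lam (k + row_offset \<sigma> - 1) \<le> lam (Suc i + row_offset \<sigma> - 1)"
      using that by (intro antimonoD[OF am(1)]) simp
    then show ?thesis using lam_le that(1) unfolding mem by linarith
  qed
  have "((Suc i, j), (i, Suc j)) \<in> {(x, y). x \<in> boxes \<sigma> \<and> y \<in> boxes \<sigma> \<and> (x \<le> y \<or> y \<le> x)}\<^sup>*"
    using assms(2) m by (auto simp: connected_skew_def connected_poset_def)
  moreover have "fst y > i"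
    if "(x, y) \<in> {(x, y). x \<in> boxes \<sigma> \<and> y \<in> boxes \<sigma> \<and> (x \<le> y \<or> y \<le> x)}\<^sup>*" "fst x > i" for x y
    using that
  proof (induction rule: rtrancl_induct)
    case (step y z)
    obtain y1 y2 z1 z2 where yz: "y = (y1, y2)" "z = (z1, z2)" by force
    have y: "(y1, y2) \<in> boxes \<sigma>" "(z1, z2) \<in> boxes \<sigma>" "y1 > i" "y \<le> z \<or> z \<le> y"
      using step yz by auto
    show ?case using y up[OF y(2)] low[OF y(1)] by (cases "z1 > i") (auto simp: yz)
  qed
  ultimately show False by fastforce
qed

end

theory Submission
  imports Defs
begin

text \<open>
  The formula is the expectation of an identity that holds for every single subshape \<open>I\<close>. For a
  lattice point put \<open>g (i, j) = 1 - i / a - j / b\<close>, so that \<open>g\<close> is the displacement of a northwest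
  corner and \<open>- g\<close> that of a southeast corner, and \<open>g\<close> vanishes at the ends \<open>(a, 0)\<close> and \<open>(0, b)\<close>
  of every lattice path.

  Follow the path of \<open>I\<close> from \<open>(a, 0)\<close> to \<open>(0, b)\<close> and add up \<open>g\<close> over the turns from vertical to
  horizontal, minus \<open>g\<close> over the turns from horizontal to vertical. The two turns at the ends of a
  horizontal run from column \<open>j\<close> to column \<open>j'\<close> contribute \<open>(j' - j) / b\<close>, and the horizontal runs
  have total length \<open>b\<close>, so the result is always 1 (\<open>turn_sum\<close>).

  Connectedness makes each turn either a toggle or an outward corner
  (\<open>inner_turn_cases\<close>, \<open>outer_turn_cases\<close>). At a turn \<open>(i, j)\<close> from vertical to horizontal, the box
  \<open>[i + 1, j + 1]\<close> can be toggled in if it belongs to the shape, and otherwise \<open>(i, j)\<close> is a southeast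
  corner; at a turn from horizontal to vertical, the box \<open>[i, j]\<close> can be toggled out, or \<open>(i, j)\<close> is a
  northwest corner. All toggles arise in this way. With \<open>2 * K = 1 / a + 1 / b\<close>, a box \<open>p\<close> that can
  be toggled in thus contributes \<open>g p + 2 * K\<close> to the sum over turns, because the turn lies one step
  northwest of the southeast corner of \<open>p\<close>, and a box that can be toggled out contributes \<open>- g p\<close>. These
  are \<open>K + (g p + K)\<close> and \<open>K - (g p + K)\<close>: every toggle counts \<open>K\<close>, up to a weight that is
  opposite for toggling in and toggling out. Hence
  \<open>K * jag I = 1 + (\<Sum>c. \<delta>(c) * [c on the path]) - (\<Sum>p. (g p + K) * (T\<^sup>+ p - T\<^sup>- p))\<close>,
  where \<open>T\<^sup>+ p\<close> and \<open>T\<^sup>- p\<close> indicate that \<open>p\<close> can be toggled in and out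
  (\<open>jag_identity\<close>, \<open>jag_pointwise\<close>). Toggle-symmetry says exactly that the last sum
  has expectation 0, and \<open>1 / K = 2 * a * b / (a + b)\<close>.
\<close>

section \<open>Shapes given by their rows\<close>

text \<open>The properties of a connected skew shape that the argument uses, in rectangle coordinates: row
  \<open>i\<close> occupies the columns \<open>N i + 1\<close> to \<open>L i\<close>, and any two adjacent rows share a column.\<close>

locale overlapping_rows =
  fixes S :: "box set" and a b :: nat and N L :: "nat \<Rightarrow> nat"
  assumes mem: "(i, j) \<in> S \<longleftrightarrow> 1 \<le> i \<and> i \<le> a \<and> N i < j \<and> j \<le> L i"
    and anti_N: "antimono N" and anti_L: "antimono L"
    and overlap: "1 \<le> i \<Longrightarrow> i < a \<Longrightarrow> N i < L (Suc i)"
    and first_row: "L 1 = b" and last_row: "N a = 0"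
    and a_pos: "1 \<le> a" and b_pos: "1 \<le> b"
    and L_pos: "1 \<le> L a"
begin

lemma row_nonempty:
  assumes "1 \<le> i" "i \<le> a" shows "N i < L i"
proof (cases "i = a")
  case True
  then show ?thesis using last_row L_pos by simp
next
  case False
  then show ?thesis
    using overlap[of i] antimonoD[OF anti_L, of i "Suc i"] assms by simp
qed

lemma finite_S: "finite S"
proof (rule finite_subset)
  show "S \<subseteq> {..a} \<times> {..L 0}"
  proof
    fix p assume "p \<in> S"
    moreover obtain i j where "p = (i, j)" by force
    ultimately show "p \<in> {..a} \<times> {..L 0}"
      using mem[of i j] antimonoD[OF anti_L, of 0 i] by auto
  qed
qed simp

definition gap :: "point \<Rightarrow> real" where
  "gap = (\<lambda>(i, j). 1 - real i / real a - real j / real b)"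

definition nw_points :: "point set" where
  "nw_points = {(i, j). (i, j) \<notin> S \<and> (i + 1, j) \<in> S \<and> (i, j + 1) \<in> S}"

definition se_points :: "point set" where
  "se_points = {(i, j). (i + 1, j + 1) \<notin> S \<and> (i + 1, j) \<in> S \<and> (i, j + 1) \<in> S}"

end

section \<open>Turns of a lattice path\<close>

text \<open>A subshape whose row \<open>i\<close> ends in column \<open>r i\<close>. The values at \<open>0\<close> and \<open>a + 1\<close> are the columns
  where the path ends and starts, which makes the turns in the first and last row regular.\<close>

locale row_ends = overlapping_rows +
  fixes r :: "nat \<Rightarrow> nat"
  assumes r_first: "r 0 = b" and r_last: "r (Suc a) = 0" and anti_r: "antimono r"
    and r_ge: "1 \<le> i \<Longrightarrow> i \<le> a \<Longrightarrow> N i \<le> r i"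
    and r_le: "1 \<le> i \<Longrightarrow> i \<le> a \<Longrightarrow> r i \<le> L i"
begin

definition below :: "box set" where
  "below = {(i, j). 1 \<le> i \<and> i \<le> a \<and> N i < j \<and> j \<le> r i}"

text \<open>The points where the path from \<open>(a, 0)\<close> to \<open>(0, b)\<close> turns from vertical to horizontal; they
  point into the subshape.\<close>

definition inner_turns :: "point set" where
  "inner_turns = {(i, j). i < a \<and> j = r (Suc i) \<and> j < r i}"

text \<open>The points where the path turns from horizontal to vertical.\<close>

definition outer_turns :: "point set" where
  "outer_turns = {(i, j). 1 \<le> i \<and> i \<le> a \<and> j = r i \<and> r (Suc i) < j}"

lemma finite_turns: "finite inner_turns" "finite outer_turns"
proof -
  have "inner_turns \<subseteq> (\<lambda>i. (i, r (Suc i))) ` {..<a}" by (auto simp: inner_turns_def)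
  then show "finite inner_turns" by (rule finite_subset) simp
  have "outer_turns \<subseteq> (\<lambda>i. (i, r i)) ` {..a}" by (auto simp: outer_turns_def)
  then show "finite outer_turns" by (rule finite_subset) simp
qed

text \<open>On the horizontal line \<open>i\<close> the path runs from column \<open>r (i + 1)\<close> to column \<open>r i\<close>. Only the
  column term of \<open>gap\<close> changes along this run, so the run contributes its length divided by \<open>b\<close>,
  also when it is empty, and the lengths telescope.\<close>

lemma turn_sum:
  "(\<Sum>p\<in>inner_turns. gap p) - (\<Sum>p\<in>outer_turns. gap p) = 1"
proof -
  have ab: "real a > 0" "real b > 0" using a_pos b_pos by auto
  let ?c = "\<lambda>i. r (Suc i) < r i"
  have "inner_turns = (\<lambda>i. (i, r (Suc i))) ` {i\<in>{..<a}. ?c i}"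
    by (auto simp: inner_turns_def)
  then have "(\<Sum>p\<in>inner_turns. gap p) = (\<Sum>i\<in>{i\<in>{..<a}. ?c i}. gap (i, r (Suc i)))"
    by (simp add: sum.reindex inj_on_def)
  also have "\<dots> = (\<Sum>i<a. if ?c i then gap (i, r (Suc i)) else 0)"
    by (rule sum.inter_filter) simp
  \<comment> \<open>A run on line \<open>a\<close> starts at \<open>(a, 0)\<close>, which is no turn, but \<open>gap\<close> vanishes there.\<close>
  also have "\<dots> = (\<Sum>i<Suc a. if ?c i then gap (i, r (Suc i)) else 0)"
    using ab by (simp add: gap_def r_last)
  finally have 1: "(\<Sum>p\<in>inner_turns. gap p) = (\<Sum>i<Suc a. if ?c i then gap (i, r (Suc i)) else 0)" .
  have "outer_turns = (\<lambda>i. (i, r i)) ` {i\<in>{1..<Suc a}. ?c i}"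
    by (auto simp: outer_turns_def)
  then have "(\<Sum>p\<in>outer_turns. gap p) = (\<Sum>i\<in>{i\<in>{1..<Suc a}. ?c i}. gap (i, r i))"
    by (simp add: sum.reindex inj_on_def)
  also have "\<dots> = (\<Sum>i=1..<Suc a. if ?c i then gap (i, r i) else 0)"
    by (rule sum.inter_filter) simp
  \<comment> \<open>Likewise a run on line \<open>0\<close> ends at \<open>(0, b)\<close>.\<close>
  also have "\<dots> = (\<Sum>i<Suc a. if ?c i then gap (i, r i) else 0)"
    using ab by (simp add: lessThan_atLeast0 sum.atLeast_Suc_lessThan[of 0] gap_def r_first del: sum.op_ivl_Suc)
  finally have 2: "(\<Sum>p\<in>outer_turns. gap p) = (\<Sum>i<Suc a. if ?c i then gap (i, r i) else 0)" .
  have "(\<Sum>p\<in>inner_turns. gap p) - (\<Sum>p\<in>outer_turns. gap p)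
      = (\<Sum>i<Suc a. (if ?c i then gap (i, r (Suc i)) else 0) - (if ?c i then gap (i, r i) else 0))"
    by (simp only: 1 2 sum_subtractf)
  also have "\<dots> = (\<Sum>i<Suc a. real (r i) / b - real (r (Suc i)) / b)"
  proof (rule sum.cong)
    fix i
    have "r (Suc i) \<le> r i" using antimonoD[OF anti_r] by simp
    then show "(if ?c i then gap (i, r (Suc i)) else 0) - (if ?c i then gap (i, r i) else 0)
        = real (r i) / b - real (r (Suc i)) / b"
      by (auto simp: gap_def)
  qed simp
  also have "\<dots> = 1"
    using ab sum_lessThan_telescope'[of "\<lambda>i. real (r i) / b" "Suc a"] by (simp add: r_first r_last)
  finally show ?thesis .
qed

text \<open>A box outside the subshape is minimal there exactly if its left and upper neighbours do not lie
  outside as well. This says that its row of the subshape ends just before it and that the row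
  above reaches at least as far as the box, so that the path turns at its northwest corner.\<close>

lemma can_toggle_in_iff:
  "can_toggle_in S (Suc i, Suc j) below \<longleftrightarrow> (i, j) \<in> inner_turns \<and> (Suc i, Suc j) \<in> S"
proof
  assume "can_toggle_in S (Suc i, Suc j) below"
  then have S: "(Suc i, Suc j) \<in> S" and nb: "(Suc i, Suc j) \<notin> below"
    and min: "\<And>q. q \<in> S \<Longrightarrow> q \<notin> below \<Longrightarrow> q \<le> (Suc i, Suc j) \<Longrightarrow> q = (Suc i, Suc j)"
    by (auto simp: can_toggle_in_def)
  have i: "i < a" and N: "N (Suc i) \<le> j" and L: "Suc j \<le> L (Suc i)"
    using S by (auto simp: mem)
  have rj: "r (Suc i) \<le> j" using nb N i by (auto simp: below_def)
  have "j \<le> r (Suc i)"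
  proof (rule ccontr)
    assume "\<not> j \<le> r (Suc i)"
    then have "(Suc i, j) \<in> S" "(Suc i, j) \<notin> below"
      using i L r_ge[of "Suc i"] by (auto simp: mem below_def)
    then show False using min by fastforce
  qed
  moreover have "j < r i"
  proof (cases i)
    case 0
    then show ?thesis using L first_row by (simp add: r_first)
  next
    case (Suc k)
    show ?thesis
    proof (rule ccontr)
      assume "\<not> j < r i"
      then have "(i, Suc j) \<in> S" "(i, Suc j) \<notin> below"
        using i L Suc r_ge[of i] antimonoD[OF anti_L, of i "Suc i"] by (auto simp: mem below_def)
      then show False using min by fastforce
    qed
  qed
  ultimately show "(i, j) \<in> inner_turns \<and> (Suc i, Suc j) \<in> S"
    using S i rj by (simp add: inner_turns_def)
next
  assume h: "(i, j) \<in> inner_turns \<and> (Suc i, Suc j) \<in> S"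
  then have j: "j = r (Suc i)" "j < r i" by (auto simp: inner_turns_def)
  have "q = (Suc i, Suc j)" if q: "q \<in> S" "q \<notin> below" "q \<le> (Suc i, Suc j)" for q
  proof -
    obtain k l where kl: "q = (k, l)" by force
    have le: "k \<le> Suc i" "l \<le> Suc j" and rl: "r k < l"
      using q by (auto simp: kl mem below_def)
    have "k = Suc i"
    proof (rule ccontr)
      assume "k \<noteq> Suc i"
      then have "r i \<le> r k" using le by (intro antimonoD[OF anti_r]) simp
      then show False using j le rl by simp
    qed
    then show ?thesis using j le rl by (simp add: kl)
  qed
  then show "can_toggle_in S (Suc i, Suc j) below"
    using h j by (auto simp: can_toggle_in_def below_def)
qed

lemma can_toggle_out_iff:
  "can_toggle_out S p below \<longleftrightarrow> p \<in> outer_turns \<and> p \<in> S"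
proof -
  obtain i j where p: "p = (i, j)" by force
  show ?thesis
  proof
    assume "can_toggle_out S p below"
    then have S: "(i, j) \<in> S" and b: "(i, j) \<in> below"
      and max: "\<And>q. q \<in> below \<Longrightarrow> (i, j) \<le> q \<Longrightarrow> q = (i, j)"
      by (auto simp: can_toggle_out_def p)
    have i: "1 \<le> i" "i \<le> a" and N: "N i < j" and rj: "j \<le> r i"
      using b by (auto simp: below_def)
    have "(i, r i) \<in> below" using i N rj by (auto simp: below_def)
    then have j: "j = r i" using max[of "(i, r i)"] rj by simp
    have "r (Suc i) < j"
    proof (rule ccontr)
      assume n: "\<not> r (Suc i) < j"
      have "i \<noteq> a" using n r_last N by auto
      moreover have "N (Suc i) \<le> N i" by (intro antimonoD[OF anti_N]) simp
      ultimately have "(Suc i, j) \<in> below" using n i N by (auto simp: below_def)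
      then show False using max by fastforce
    qed
    then show "p \<in> outer_turns \<and> p \<in> S" using S i j by (simp add: p outer_turns_def)
  next
    assume h: "p \<in> outer_turns \<and> p \<in> S"
    then have j: "j = r i" "r (Suc i) < j" by (auto simp: p outer_turns_def)
    have "q = (i, j)" if q: "q \<in> below" "(i, j) \<le> q" for q
    proof -
      obtain k l where kl: "q = (k, l)" by force
      have le: "i \<le> k" "j \<le> l" and rl: "l \<le> r k"
        using q by (auto simp: kl below_def)
      have "k = i"
      proof (rule ccontr)
        assume "k \<noteq> i"
        then have "r k \<le> r (Suc i)" using le by (intro antimonoD[OF anti_r]) simp
        then show False using j le rl by simp
      qed
      then show ?thesis using j le rl by (simp add: kl)
    qed
    then show "can_toggle_out S p below"
      using h j by (auto simp: p can_toggle_out_def below_def mem)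
  qed
qed

text \<open>If the box southeast of the turn is missing, then row \<open>i + 1\<close> of the subshape is a full row
  of the shape. Since that row is nonempty, and row \<open>i\<close> contains a box in the column after
  it, the turn is an outward corner. It does not lie on the line \<open>0\<close>, as the first row of the
  shape extends to column \<open>b\<close>.\<close>

lemma inner_turn_cases:
  assumes "(i, j) \<in> inner_turns"
  shows "(Suc i, Suc j) \<in> S \<longleftrightarrow> (i, j) \<notin> se_points"
proof -
  have t: "i < a" "j = r (Suc i)" "j < r i" using assms by (auto simp: inner_turns_def)
  have "(i, j) \<in> se_points" if n: "(Suc i, Suc j) \<notin> S"
  proof -
    have j: "j = L (Suc i)" using n t r_ge[of "Suc i"] r_le[of "Suc i"] by (auto simp: mem)
    then have i: "1 \<le> i" using t first_row r_first by (cases i) auto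
    then show ?thesis
      using n t j row_nonempty[of "Suc i"] overlap[of i] r_le[of i]
      by (auto simp: se_points_def mem)
  qed
  then show ?thesis by (auto simp: se_points_def)
qed

text \<open>If the box northwest of the turn is missing, then row \<open>i\<close> of the subshape is empty. This happens
  above row \<open>a\<close> only, because row \<open>a\<close> begins in column 1, and the overlap of rows \<open>i\<close> and
  \<open>i + 1\<close> provides the box southwest of the turn.\<close>

lemma outer_turn_cases:
  assumes "(i, j) \<in> outer_turns"
  shows "(i, j) \<in> S \<longleftrightarrow> (i, j) \<notin> nw_points"
proof -
  have t: "1 \<le> i" "i \<le> a" "j = r i" "r (Suc i) < j" using assms by (auto simp: outer_turns_def)
  have "(i, j) \<in> nw_points" if n: "(i, j) \<notin> S"
  proof -
    have j: "j = N i" using n t r_ge[of i] r_le[of i] by (auto simp: mem)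
    then have i: "i < a" using t last_row by (cases "i = a") auto
    then show ?thesis
      using n t j row_nonempty[of i] overlap[of i] r_ge[of "Suc i"]
      by (auto simp: nw_points_def mem)
  qed
  then show ?thesis by (auto simp: nw_points_def)
qed

abbreviation toggle_diff :: "box \<Rightarrow> real" where
  "toggle_diff p \<equiv> indicator {I. can_toggle_in S p I} below - indicator {I. can_toggle_out S p I} below"

text \<open>The toggle weight \<open>gap p + K\<close> is forced by the two requirements that a box \<open>p\<close> toggled in
  contributes \<open>gap\<close> at the northwest corner of \<open>p\<close> and a box toggled out contributes \<open>- gap\<close> at its
  southeast corner.\<close>

lemma jag_identity:
  fixes K :: real
  assumes K: "2 * K = 1 / real a + 1 / real b"
  shows "K * real (jag S below) = 1 + (\<Sum>p\<in>nw_points \<inter> outer_turns. gap p)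
    - (\<Sum>p\<in>se_points \<inter> inner_turns. gap p) - (\<Sum>p\<in>S. (gap p + K) * toggle_diff p)"
proof -
  define A where "A = {p\<in>S. can_toggle_in S p below}"
  define B where "B = {p\<in>S. can_toggle_out S p below}"
  have fin: "finite A" "finite B" using finite_S by (auto simp: A_def B_def)
  have "A \<inter> B = {}" by (auto simp: A_def B_def can_toggle_in_def can_toggle_out_def)
  moreover have "{p \<in> S. can_toggle_in S p below \<or> can_toggle_out S p below} = A \<union> B"
    by (auto simp: A_def B_def)
  ultimately have jag: "real (jag S below) = real (card A) + real (card B)"
    using fin by (simp add: jag_def card_Un_disjoint)
  have diff: "(\<Sum>p\<in>S. (gap p + K) * toggle_diff p) = (\<Sum>p\<in>A. gap p + K) - (\<Sum>p\<in>B. gap p + K)"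
    unfolding A_def B_def sum.inter_filter[OF finite_S] sum_subtractf[symmetric]
    by (rule sum.cong) (auto simp: indicator_def)
  have A: "A = (\<lambda>(i, j). (Suc i, Suc j)) ` (inner_turns - se_points)"
  proof (intro set_eqI iffI)
    fix p assume p: "p \<in> A"
    then have "p \<in> S" by (simp add: A_def)
    then obtain i j where ij: "p = (Suc i, Suc j)"
      using mem by (metis Suc_le_D less_imp_Suc_add not0_implies_Suc not_less_zero One_nat_def surj_pair)
    then have "(i, j) \<in> inner_turns - se_points"
      using p can_toggle_in_iff inner_turn_cases by (auto simp: A_def)
    then show "p \<in> (\<lambda>(i, j). (Suc i, Suc j)) ` (inner_turns - se_points)" by (force simp: ij)
  next
    fix p assume "p \<in> (\<lambda>(i, j). (Suc i, Suc j)) ` (inner_turns - se_points)"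
    then show "p \<in> A" using can_toggle_in_iff inner_turn_cases by (auto simp: A_def)
  qed
  have B: "B = outer_turns - nw_points"
    using can_toggle_out_iff outer_turn_cases by (auto simp: B_def)
  have shift: "gap (Suc i, Suc j) + 2 * K = gap (i, j)" for i j
    by (simp add: gap_def K add_divide_distrib)
  have "K * real (card A) + (\<Sum>p\<in>A. gap p + K) = (\<Sum>p\<in>A. gap p + 2 * K)"
    by (simp add: sum.distrib algebra_simps)
  also have "\<dots> = (\<Sum>p\<in>inner_turns - se_points. gap p)"
    unfolding A by (subst sum.reindex) (auto simp: inj_on_def shift intro!: sum.cong)
  finally have 1: "K * real (card A) + (\<Sum>p\<in>A. gap p + K) = (\<Sum>p\<in>inner_turns - se_points. gap p)" .
  have 2: "K * real (card B) - (\<Sum>p\<in>B. gap p + K) = - (\<Sum>p\<in>outer_turns - nw_points. gap p)"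
    by (simp add: B sum.distrib algebra_simps)
  have 3: "(\<Sum>p\<in>T. gap p) = (\<Sum>p\<in>X \<inter> T. gap p) + (\<Sum>p\<in>T - X. gap p)" if "finite T" for T X
    using sum.Int_Diff[OF that, of gap X] by (simp add: Int_commute)
  show ?thesis
    using 1 2 3[OF finite_turns(1), of se_points] 3[OF finite_turns(2), of nw_points] turn_sum
    unfolding jag diff by (simp add: distrib_left)
qed

end

section \<open>The steps of a lattice path\<close>

lemma set_zip_tl_append:
  assumes "xs \<noteq> []" "ys \<noteq> []"
  shows "set (zip (xs @ ys) (tl (xs @ ys))) =
    set (zip xs (tl xs)) \<union> {(last xs, hd ys)} \<union> set (zip ys (tl ys))"
  using assms(1)
proof (induction xs rule: list_nonempty_induct)
  case (single x)
  then show ?case using assms(2) by (cases ys) auto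
next
  case (cons x xs)
  then show ?case by (cases xs) auto
qed

lemma set_zip_tl_map_upt:
  "m \<le> n \<Longrightarrow> set (zip (map f [m..<Suc n]) (tl (map f [m..<Suc n]))) = {(f j, f (Suc j)) | j. m \<le> j \<and> j < n}"
proof (induction n rule: dec_induct)
  case base
  then show ?case by simp
next
  case (step n)
  have "map f [m..<Suc (Suc n)] = map f [m..<Suc n] @ [f (Suc n)]"
    using step by simp
  moreover have "last (map f [m..<Suc n]) = f n" using step by simp
  ultimately show ?case
    using step by (subst (1 2) \<open>map f [m..<Suc (Suc n)] = _\<close>, subst set_zip_tl_append) (auto simp: less_Suc_eq)
qed

definition staircase :: "(nat \<Rightarrow> nat) \<Rightarrow> nat \<Rightarrow> point list" where
  "staircase r k = concat (map (\<lambda>i. map (Pair i) [r (Suc i) ..< Suc (r i)]) (rev [0 ..< Suc k]))"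

text \<open>Consecutive points on one line give the horizontal steps. Line \<open>i + 1\<close> ends and line \<open>i\<close>
  begins in column \<open>r (i + 1)\<close>, so passing from one line to the next is a vertical step.\<close>

lemma staircase_steps:
  assumes "antimono r"
  shows "set (zip (staircase r k) (tl (staircase r k))) =
    {((Suc i, r (Suc i)), (i, r (Suc i))) | i. i < k} \<union>
    {((i, j), (i, Suc j)) | i j. i \<le> k \<and> r (Suc i) \<le> j \<and> j < r i}"
proof -
  define level where "level i = map (Pair i) [r (Suc i) ..< Suc (r i)]" for i
  define ps where "ps k = staircase r k" for k
  have le: "r (Suc i) \<le> r i" for i using antimonoD[OF assms(1)] by simp
  have level_ne: "level i \<noteq> []" for i using le[of i] by (simp add: level_def)
  have level_hd: "hd (level i) = (i, r (Suc i))" for i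
    using le[of i] by (simp add: level_def hd_map del: upt_Suc)
  have level_last: "last (level i) = (i, r i)" for i
    using le[of i] by (simp add: level_def)
  have level_steps: "set (zip (level i) (tl (level i))) = {((i, j), (i, Suc j)) | j. r (Suc i) \<le> j \<and> j < r i}" for i
    unfolding level_def by (rule set_zip_tl_map_upt[OF le])
  have ps_Suc: "ps (Suc k) = level (Suc k) @ ps k" for k by (simp add: ps_def staircase_def level_def)
  have ps_0: "ps 0 = level 0" by (simp add: ps_def staircase_def level_def)
  have ps_ne: "ps k \<noteq> []" for k using level_ne by (cases k) (auto simp: ps_Suc ps_0)
  have ps_hd: "hd (ps k) = (k, r (Suc k))" for k
    using level_ne level_hd by (cases k) (auto simp: ps_Suc ps_0)
  have "set (zip (ps k) (tl (ps k))) =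
    {((Suc i, r (Suc i)), (i, r (Suc i))) | i. i < k} \<union>
    {((i, j), (i, Suc j)) | i j. i \<le> k \<and> r (Suc i) \<le> j \<and> j < r i}"
  proof (induction k)
    case 0
    then show ?case by (auto simp: ps_0 level_steps)
  next
    case (Suc k)
    show ?case
      unfolding ps_Suc set_zip_tl_append[OF level_ne ps_ne] Suc level_steps level_last ps_hd
      by (auto simp: less_Suc_eq le_Suc_eq)
  qed
  then show ?thesis by (simp add: ps_def)
qed

lemma row_end_antimono:
  assumes "valid_outer \<sigma> rho" "row_end \<sigma> rho 1 \<le> width \<sigma>"
  shows "antimono (row_end \<sigma> rho)"
proof (rule antimonoI)
  have am: "antimono rho" using assms by (simp add: valid_outer_def is_partition_def)
  have pos: "row_end \<sigma> rho k \<le> row_end \<sigma> rho i" if "1 \<le> i" "i \<le> k" for i k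
    using antimonoD[OF am, of "row_offset \<sigma> + i - 1" "row_offset \<sigma> + k - 1"] that
    by (auto simp: row_end_def add.commute[of i] add.commute[of k] intro!: diff_le_mono)
  fix i k :: nat assume "i \<le> k"
  then show "row_end \<sigma> rho k \<le> row_end \<sigma> rho i"
    using pos[of i k] pos[of 1 k] assms(2) by (cases "i = 0"; cases "k = 0") (auto simp: row_end_def)
qed

section \<open>Rows and columns of a connected skew shape\<close>

text \<open>A comparability chain from \<open>x\<close> to \<open>y\<close> has to cross the border of \<open>Q\<close> somewhere.\<close>

lemma connected_poset_crossing:
  assumes "connected_poset P" "x \<in> P" "Q x" "y \<in> P" "\<not> Q y"
  obtains u v where "u \<in> P" "Q u" "v \<in> P" "\<not> Q v" "u \<le> v \<or> v \<le> u"
proof -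
  have "(x, y) \<in> {(x, y). x \<in> P \<and> y \<in> P \<and> (x \<le> y \<or> y \<le> x)}\<^sup>*"
    using assms by (auto simp: connected_poset_def)
  then have "Q y \<or> (\<exists>u\<in>P. \<exists>v\<in>P. Q u \<and> \<not> Q v \<and> (u \<le> v \<or> v \<le> u))"
    using assms(3) by (induction rule: rtrancl_induct) blast+
  then show ?thesis using assms(5) that by blast
qed

lemma initial_segment_card:
  fixes X :: "nat set"
  assumes "finite X" "X \<noteq> {}" "0 \<notin> X" "\<And>m i. m \<in> X \<Longrightarrow> 1 \<le> i \<Longrightarrow> i < m \<Longrightarrow> i \<in> X"
  shows "X = {1..card X}"
proof -
  have "X = {1..Max X}"
  proof (intro set_eqI iffI)
    fix i assume "i \<in> X"
    moreover from this have "i \<noteq> 0" using assms(3) by metis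
    ultimately show "i \<in> {1..Max X}" using assms(1) by simp
  next
    fix i assume "i \<in> {1..Max X}"
    then show "i \<in> X" using assms(4)[of "Max X" i] Max_in[OF assms(1,2)] by (cases "i = Max X") auto
  qed
  then show ?thesis by (metis card_atLeastAtMost add_diff_cancel_right' Suc_eq_plus1 diff_Suc_1)
qed

lemma card_shift_down:
  fixes X :: "nat set"
  assumes "\<And>k. k \<in> X \<Longrightarrow> c < k"
  shows "card ((\<lambda>k. k - c) ` X) = card X"
  by (rule card_image) (use assms in \<open>fastforce simp: inj_on_def\<close>)

text \<open>Both ends of row \<open>i\<close> in rectangle coordinates. The subtraction cuts off at \<open>0\<close>, which is harmless
  because the columns of boxes start at 1.\<close>

definition lam_end :: "skew \<Rightarrow> nat \<Rightarrow> nat" where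
  "lam_end \<sigma> i = fst \<sigma> (i + row_offset \<sigma> - 1) - col_offset \<sigma>"

definition nu_end :: "skew \<Rightarrow> nat \<Rightarrow> nat" where
  "nu_end \<sigma> i = snd \<sigma> (i + row_offset \<sigma> - 1) - col_offset \<sigma>"

lemma mem_boxes:
  assumes "skew_shape \<sigma>"
  shows "(i, j) \<in> boxes \<sigma> \<longleftrightarrow> 1 \<le> i \<and> nu_end \<sigma> i < j
    \<and> j \<le> lam_end \<sigma> i"
  unfolding boxes_def mem_place[OF assms order_refl] by (cases \<sigma>) (auto simp: mem_diagram lam_end_def nu_end_def)

lemma mem_subshape:
  assumes "skew_shape \<sigma>" "valid_outer \<sigma> rho"
  shows "(i, j) \<in> subshape \<sigma> rho \<longleftrightarrow> 1 \<le> i \<and> nu_end \<sigma> i < j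
    \<and> j \<le> rho (i + row_offset \<sigma> - 1) - col_offset \<sigma>"
  unfolding subshape_def mem_place[OF assms(1) diagram_subset[OF assms(2)]] by (auto simp: mem_diagram nu_end_def)

lemma skew_ends_antimono:
  assumes "skew_shape \<sigma>"
  shows "antimono (lam_end \<sigma>)" "antimono (nu_end \<sigma>)"
proof -
  have "antimono (fst \<sigma>)" "antimono (snd \<sigma>)"
    using assms by (auto simp: skew_shape_def is_partition_def split: prod.splits)
  then show "antimono (lam_end \<sigma>)" "antimono (nu_end \<sigma>)"
    by (auto simp: antimono_def lam_end_def nu_end_def intro!: diff_le_mono)
qed

lemma boxes_convex:
  assumes "skew_shape \<sigma>" "(k, l) \<in> boxes \<sigma>" "(k', l') \<in> boxes \<sigma>"
    "k \<le> m" "m \<le> k'" "l \<le> n" "n \<le> l'"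
  shows "(m, n) \<in> boxes \<sigma>"
  using assms(2-) antimonoD[OF skew_ends_antimono(1)[OF assms(1)] \<open>m \<le> k'\<close>]
    antimonoD[OF skew_ends_antimono(2)[OF assms(1)] \<open>k \<le> m\<close>]
  unfolding mem_boxes[OF assms(1)] by linarith

text \<open>Connectedness yields comparable boxes \<open>u\<close> and \<open>v\<close> on the two sides of the line \<open>i\<close>, with \<open>u\<close> above.
  By convexity the column of \<open>u\<close> contains boxes of the shape all the way down to the row of \<open>v\<close>.\<close>

lemma adjacent_rows_overlap:
  assumes "skew_shape \<sigma>" "connected_skew \<sigma>"
    and "p \<in> boxes \<sigma>" "fst p \<le> i" "q \<in> boxes \<sigma>" "i < fst q"
  obtains l where "(i, l) \<in> boxes \<sigma>" "(Suc i, l) \<in> boxes \<sigma>"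
proof -
  obtain u v where uv: "u \<in> boxes \<sigma>" "fst u \<le> i" "v \<in> boxes \<sigma>" "\<not> fst v \<le> i" "u \<le> v \<or> v \<le> u"
    using connected_poset_crossing[of "boxes \<sigma>" p "\<lambda>p. fst p \<le> i" q] assms
    unfolding connected_skew_def not_le[symmetric] by metis
  then have "snd u \<le> snd v" by (auto simp: less_eq_prod_def)
  then have "(i, snd u) \<in> boxes \<sigma>" "(Suc i, snd u) \<in> boxes \<sigma>"
    using uv boxes_convex[OF assms(1), of "fst u" "snd u" "fst v" "snd v"] by auto
  then show ?thesis using that by blast
qed

lemma adjacent_columns_overlap:
  assumes "skew_shape \<sigma>" "connected_skew \<sigma>"
    and "p \<in> boxes \<sigma>" "snd p \<le> j" "q \<in> boxes \<sigma>" "j < snd q"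
  obtains k where "(k, j) \<in> boxes \<sigma>" "(k, Suc j) \<in> boxes \<sigma>"
proof -
  obtain u v where uv: "u \<in> boxes \<sigma>" "snd u \<le> j" "v \<in> boxes \<sigma>" "\<not> snd v \<le> j" "u \<le> v \<or> v \<le> u"
    using connected_poset_crossing[of "boxes \<sigma>" p "\<lambda>p. snd p \<le> j" q] assms
    unfolding connected_skew_def not_le[symmetric] by metis
  then have "fst u \<le> fst v" by (auto simp: less_eq_prod_def)
  then have "(fst u, j) \<in> boxes \<sigma>" "(fst u, Suc j) \<in> boxes \<sigma>"
    using uv boxes_convex[OF assms(1), of "fst u" "snd u" "fst v" "snd v"] by auto
  then show ?thesis using that by blast
qed

lemma one_in_boxes:
  assumes "skew_shape \<sigma>" "connected_skew \<sigma>"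
  shows "1 \<in> fst ` boxes \<sigma>" "1 \<in> snd ` boxes \<sigma>"
proof -
  have ne: "diagram \<sigma> \<noteq> {}" using assms(2)
    by (auto simp: connected_skew_def connected_poset_def boxes_def place_def)
  have fin: "finite (diagram \<sigma>)" by (rule finite_diagram[OF assms(1)])
  have "Min (fst ` diagram \<sigma>) \<in> fst ` diagram \<sigma>" using fin ne by (intro Min_in) auto
  then obtain p where p: "p \<in> diagram \<sigma>" "fst p = Min (fst ` diagram \<sigma>)" by force
  then have "fst p - row_offset \<sigma> = 1"
    using offset_less(1)[OF assms(1), of "fst p" "snd p"] unfolding row_offset_def prod.collapse by linarith
  moreover have "(fst p - row_offset \<sigma>, snd p - col_offset \<sigma>) \<in> boxes \<sigma>"
    using p(1) by (force simp: boxes_def place_def)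
  ultimately show "1 \<in> fst ` boxes \<sigma>" by force
  have "Min (snd ` diagram \<sigma>) \<in> snd ` diagram \<sigma>" using fin ne by (intro Min_in) auto
  then obtain p where p: "p \<in> diagram \<sigma>" "snd p = Min (snd ` diagram \<sigma>)" by force
  then have "snd p - col_offset \<sigma> = 1"
    using offset_less(2)[OF assms(1), of "fst p" "snd p"] unfolding col_offset_def prod.collapse by linarith
  moreover have "(fst p - row_offset \<sigma>, snd p - col_offset \<sigma>) \<in> boxes \<sigma>"
    using p(1) by (force simp: boxes_def place_def)
  ultimately show "1 \<in> snd ` boxes \<sigma>" by force
qed

text \<open>Connectedness excludes empty rows in between, so the nonempty rows are exactly those of the
  rectangle. The same holds for columns.\<close>

lemma rows_of_boxes:
  assumes "skew_shape \<sigma>" "connected_skew \<sigma>"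
  shows "fst ` boxes \<sigma> = {1..height \<sigma>}"
proof -
  have "fst ` boxes \<sigma> = {1..card (fst ` boxes \<sigma>)}"
  proof (rule initial_segment_card)
    show "finite (fst ` boxes \<sigma>)" using finite_boxes[OF assms(1)] by simp
    show "fst ` boxes \<sigma> \<noteq> {}" using one_in_boxes[OF assms] by blast
    show "0 \<notin> fst ` boxes \<sigma>" using boxes_pos(1)[OF assms(1)] by fastforce
    fix m i assume "m \<in> fst ` boxes \<sigma>" "1 \<le> i" "i < m"
    then obtain p q where "p \<in> boxes \<sigma>" "fst p \<le> i" "q \<in> boxes \<sigma>" "i < fst q"
      using one_in_boxes(1)[OF assms] by (auto 0 3)
    then show "i \<in> fst ` boxes \<sigma>"
      by (rule adjacent_rows_overlap[OF assms]) force
  qed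
  moreover have "fst ` boxes \<sigma> = (\<lambda>k. k - row_offset \<sigma>) ` fst ` diagram \<sigma>"
    by (force simp: boxes_def place_def)
  then have "card (fst ` boxes \<sigma>) = height \<sigma>"
    unfolding height_def using offset_less(1)[OF assms(1)] by (auto intro!: card_shift_down)
  ultimately show ?thesis by simp
qed

lemma columns_of_boxes:
  assumes "skew_shape \<sigma>" "connected_skew \<sigma>"
  shows "snd ` boxes \<sigma> = {1..width \<sigma>}"
proof -
  have "snd ` boxes \<sigma> = {1..card (snd ` boxes \<sigma>)}"
  proof (rule initial_segment_card)
    show "finite (snd ` boxes \<sigma>)" using finite_boxes[OF assms(1)] by simp
    show "snd ` boxes \<sigma> \<noteq> {}" using one_in_boxes[OF assms] by blast
    show "0 \<notin> snd ` boxes \<sigma>" using boxes_pos(2)[OF assms(1)] by fastforce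
    fix m j assume "m \<in> snd ` boxes \<sigma>" "1 \<le> j" "j < m"
    then obtain p q where "p \<in> boxes \<sigma>" "snd p \<le> j" "q \<in> boxes \<sigma>" "j < snd q"
      using one_in_boxes(2)[OF assms] by (auto 0 3)
    then show "j \<in> snd ` boxes \<sigma>"
      by (rule adjacent_columns_overlap[OF assms]) force
  qed
  moreover have "snd ` boxes \<sigma> = (\<lambda>k. k - col_offset \<sigma>) ` snd ` diagram \<sigma>"
    by (force simp: boxes_def place_def)
  then have "card (snd ` boxes \<sigma>) = width \<sigma>"
    unfolding width_def using offset_less(2)[OF assms(1)] by (auto intro!: card_shift_down)
  ultimately show ?thesis by simp
qed

lemma connected_skew_overlapping_rows:
  assumes "skew_shape \<sigma>" "connected_skew \<sigma>"
  shows "overlapping_rows (boxes \<sigma>) (height \<sigma>) (width \<sigma>)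
    (nu_end \<sigma>) (lam_end \<sigma>)"
    (is "overlapping_rows _ ?a ?b ?N ?L")
proof
  note mem = mem_boxes[OF assms(1)]
  note rows = rows_of_boxes[OF assms] and cols = columns_of_boxes[OF assms]
  show antiN: "antimono ?N" and antiL: "antimono ?L" by (rule skew_ends_antimono[OF assms(1)])+
  show "(i, j) \<in> boxes \<sigma> \<longleftrightarrow> 1 \<le> i \<and> i \<le> ?a \<and> ?N i < j \<and> j \<le> ?L i" for i j
    using mem[of i j] rows by (metis atLeastAtMost_iff fst_conv image_eqI)
  have row_ex: "\<exists>l. (i, l) \<in> boxes \<sigma>" if "1 \<le> i" "i \<le> ?a" for i
  proof -
    have "i \<in> fst ` boxes \<sigma>" using that by (simp add: rows)
    then show ?thesis by force
  qed
  have col_ex: "\<exists>k. (k, j) \<in> boxes \<sigma>" if "1 \<le> j" "j \<le> ?b" for j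
  proof -
    have "j \<in> snd ` boxes \<sigma>" using that by (simp add: cols)
    then show ?thesis by force
  qed
  show a: "1 \<le> ?a" using one_in_boxes(1)[OF assms] rows by simp
  show b: "1 \<le> ?b" using one_in_boxes(2)[OF assms] cols by simp
  show "1 \<le> ?L ?a" using row_ex[OF a] by (auto simp: mem)
  show "?N i < ?L (Suc i)" if "1 \<le> i" "i < ?a" for i
  proof -
    have i: "1 \<le> i" "i \<le> ?a" "1 \<le> Suc i" "Suc i \<le> ?a" using that by auto
    obtain l where "(i, l) \<in> boxes \<sigma>" using row_ex[OF i(1,2)] by blast
    moreover obtain l' where "(Suc i, l') \<in> boxes \<sigma>" using row_ex[OF i(3,4)] by blast
    ultimately obtain m where "(i, m) \<in> boxes \<sigma>" "(Suc i, m) \<in> boxes \<sigma>"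
      using adjacent_rows_overlap[OF assms, of "(i, l)" i "(Suc i, l')"] by auto
    then show ?thesis unfolding mem by linarith
  qed
  show "?L 1 = ?b"
  proof (rule antisym)
    obtain l where "(1, l) \<in> boxes \<sigma>" using row_ex a by blast
    then have "(1, ?L 1) \<in> boxes \<sigma>" unfolding mem by linarith
    then show "?L 1 \<le> ?b" using cols by (metis atLeastAtMost_iff image_eqI snd_conv)
    obtain k where k: "(k, ?b) \<in> boxes \<sigma>" using col_ex b by blast
    then have "?L k \<le> ?L 1" unfolding mem by (intro antimonoD[OF antiL]) simp
    then show "?b \<le> ?L 1" using k unfolding mem by linarith
  qed
  show "?N ?a = 0"
  proof -
    obtain k where k: "(k, 1) \<in> boxes \<sigma>" using col_ex b by blast
    then have "k \<le> ?a" using rows by (metis atLeastAtMost_iff image_eqI fst_conv)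
    then have "?N ?a \<le> ?N k" by (rule antimonoD[OF antiN])
    then show ?thesis using k unfolding mem by linarith
  qed
qed

section \<open>The identity for a single subshape\<close>

lemma valid_outer_row_ends:
  assumes "skew_shape \<sigma>" "connected_skew \<sigma>" "valid_outer \<sigma> rho"
  shows "row_ends (boxes \<sigma>) (height \<sigma>) (width \<sigma>)
    (nu_end \<sigma>) (lam_end \<sigma>)
    (row_end \<sigma> rho)"
    (is "row_ends _ ?a ?b ?N ?L ?r")
proof -
  interpret overlapping_rows "boxes \<sigma>" ?a ?b ?N ?L
    by (rule connected_skew_overlapping_rows[OF assms(1,2)])
  have r: "?r i = rho (i + row_offset \<sigma> - 1) - col_offset \<sigma>" if "1 \<le> i" "i \<le> ?a" for i
    using that by (simp add: row_end_def add.commute)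
  have ge: "?N i \<le> ?r i" and le: "?r i \<le> ?L i" if "1 \<le> i" "i \<le> ?a" for i
    using assms(3) by (auto simp: r[OF that] lam_end_def nu_end_def valid_outer_def le_fun_def intro!: diff_le_mono)
  show ?thesis
  proof
    show "antimono ?r" using row_end_antimono[OF assms(3)] le[of 1] first_row a_pos by simp
    show "?N i \<le> ?r i" "?r i \<le> ?L i" if "1 \<le> i" "i \<le> ?a" for i by (rule ge[OF that] le[OF that])+
  qed (simp_all add: row_end_def)
qed

lemma subshape_eq_below:
  assumes "skew_shape \<sigma>" "connected_skew \<sigma>" "valid_outer \<sigma> rho"
  shows "subshape \<sigma> rho = row_ends.below (height \<sigma>)
    (nu_end \<sigma>) (row_end \<sigma> rho)"
    (is "_ = row_ends.below ?a ?N ?r")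
proof -
  let ?L = "lam_end \<sigma>"
  interpret row_ends "boxes \<sigma>" ?a "width \<sigma>" ?N ?L ?r by (rule valid_outer_row_ends[OF assms])
  have "subshape \<sigma> rho \<subseteq> boxes \<sigma>"
    using diagram_subset[OF assms(3)] by (auto simp: subshape_def boxes_def place_def)
  then have "i \<le> ?a" if "(i, j) \<in> subshape \<sigma> rho" for i j using that mem by blast
  moreover have "?r i = rho (i + row_offset \<sigma> - 1) - col_offset \<sigma>" if "1 \<le> i" "i \<le> ?a" for i
    using that by (simp add: row_end_def add.commute)
  ultimately have "(i, j) \<in> subshape \<sigma> rho \<longleftrightarrow> (i, j) \<in> below" for i j
    unfolding mem_subshape[OF assms(1,3)] below_def by (auto 0 3)
  then show ?thesis by auto
qed

lemma lattice_path_steps: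
  assumes "skew_shape \<sigma>" "valid_outer \<sigma> rho" "antimono (row_end \<sigma> rho)"
  defines "r \<equiv> row_end \<sigma> rho"
  shows "set (lattice_path \<sigma> (subshape \<sigma> rho)) =
    {((Suc i, r (Suc i)), (i, r (Suc i))) | i. i < height \<sigma>} \<union>
    {((i, j), (i, Suc j)) | i j. i \<le> height \<sigma> \<and> r (Suc i) \<le> j \<and> j < r i}"
  using staircase_steps[OF assms(3), of "height \<sigma>"]
  by (simp add: lattice_path_def outer_subshape[OF assms(1,2)] border_points_def staircase_def r_def Let_def del: upt_Suc)

text \<open>The event whose probability is \<open>corner_prob\<close>.\<close>

definition path_contains :: "skew \<Rightarrow> box set \<Rightarrow> step \<times> step \<Rightarrow> bool" where
  "path_contains \<sigma> I c \<longleftrightarrow> fst c \<in> set (lattice_path \<sigma> I) \<and> snd c \<in> set (lattice_path \<sigma> I)"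

definition nw_corner :: "point \<Rightarrow> step \<times> step" where
  "nw_corner = (\<lambda>(i, j). (((i, j - 1), (i, j)), ((i, j), (i - 1, j))))"

definition se_corner :: "point \<Rightarrow> step \<times> step" where
  "se_corner = (\<lambda>(i, j). (((i + 1, j), (i, j)), ((i, j), (i, j + 1))))"

lemma sum_outward_corners:
  fixes f :: "step \<times> step \<Rightarrow> real"
  assumes "skew_shape \<sigma>" "connected_skew \<sigma>"
  shows "(\<Sum>c\<in>outward_corners \<sigma>. f c) =
    (\<Sum>p | northwest_at \<sigma> p. f (nw_corner p)) + (\<Sum>p | southeast_at \<sigma> p. f (se_corner p))"
proof -
  have corners: "outward_corners \<sigma> = nw_corner ` {p. northwest_at \<sigma> p} \<union> se_corner ` {p. southeast_at \<sigma> p}"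
    unfolding outward_corner_cases[OF assms(1)] nw_corner_def se_corner_def by force
  have "nw_corner ` {p. northwest_at \<sigma> p} \<inter> se_corner ` {p. southeast_at \<sigma> p} = {}"
    using not_northwest_and_southeast[OF assms] by (auto simp: nw_corner_def se_corner_def)
  moreover have "inj nw_corner" "inj se_corner"
    by (auto simp: inj_on_def nw_corner_def se_corner_def)
  ultimately show ?thesis
    using finite_outward_corners[OF assms(1)] unfolding corners
    by (simp add: sum.union_disjoint sum.reindex inj_on_subset[of _ UNIV])
qed

text \<open>Translation of \<open>jag_identity\<close>: the path contains both steps of a northwest corner exactly if it
  turns there from horizontal to vertical, and both steps of a southeast corner exactly if it turns
  there from vertical to horizontal.\<close>

lemma jag_pointwise:
  fixes \<sigma> :: skew
  defines "a \<equiv> height \<sigma>" and "b \<equiv> width \<sigma>"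
  defines "K \<equiv> (1 / real a + 1 / real b) / 2"
  assumes "skew_shape \<sigma>" "connected_skew \<sigma>" "I \<in> subshapes \<sigma>"
  shows "K * real (jag (boxes \<sigma>) I) = 1
    + (\<Sum>c\<in>outward_corners \<sigma>. displacement \<sigma> c * indicator {I. path_contains \<sigma> I c} I)
    - (\<Sum>p\<in>boxes \<sigma>. (1 - real (fst p) / a - real (snd p) / b + K) *
        (indicator {I. can_toggle_in (boxes \<sigma>) p I} I - indicator {I. can_toggle_out (boxes \<sigma>) p I} I))"
proof -
  let ?N = "nu_end \<sigma>"
  let ?L = "lam_end \<sigma>"
  obtain rho where rho: "valid_outer \<sigma> rho" "I = subshape \<sigma> rho"
    using assms(6) by (auto simp: subshapes_def)
  define r where "r = row_end \<sigma> rho"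
  interpret row_ends "boxes \<sigma>" a b ?N ?L r
    unfolding r_def a_def b_def by (rule valid_outer_row_ends[OF assms(4,5) rho(1)])
  have I: "I = below" unfolding rho(2) a_def r_def by (rule subshape_eq_below[OF assms(4,5) rho(1)])
  have path: "set (lattice_path \<sigma> I) = {((Suc i, r (Suc i)), (i, r (Suc i))) | i. i < a} \<union>
    {((i, j), (i, Suc j)) | i j. i \<le> a \<and> r (Suc i) \<le> j \<and> j < r i}"
    using lattice_path_steps[OF assms(4) rho(1)] anti_r unfolding rho(2) a_def r_def by simp
  have nw: "{p. northwest_at \<sigma> p} = nw_points" by (auto simp: northwest_at_def nw_points_def)
  have se: "{p. southeast_at \<sigma> p} = se_points" by (auto simp: southeast_at_def se_points_def)
  have fin: "finite nw_points" "finite se_points"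
  proof -
    have "nw_points \<subseteq> (\<lambda>(i, j). (i - 1, j)) ` boxes \<sigma>" by (force simp: nw_points_def)
    then show "finite nw_points" by (rule finite_subset) (simp add: finite_S)
    have "se_points \<subseteq> (\<lambda>(i, j). (i - 1, j)) ` boxes \<sigma>" by (force simp: se_points_def)
    then show "finite se_points" by (rule finite_subset) (simp add: finite_S)
  qed
  have nw_term: "displacement \<sigma> (nw_corner p) * indicator {I. path_contains \<sigma> I (nw_corner p)} I
      = (if p \<in> outer_turns then gap p else 0)" if "p \<in> nw_points" for p
  proof -
    obtain i j where p: "p = (i, j)" by force
    have n: "northwest_at \<sigma> (i, j)" using that nw by (auto simp: p)
    have pos: "1 \<le> i" "1 \<le> j" using that by (auto simp: p nw_points_def mem)
    have "displacement \<sigma> (nw_corner p) = gap p"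
      unfolding displacement_def nw_corner_def corner_point_def p gap_def Let_def
      using n by (simp add: a_def b_def)
    moreover have "path_contains \<sigma> I (nw_corner p) \<longleftrightarrow> p \<in> outer_turns"
      using pos unfolding path_contains_def path
      by (cases i; cases j) (auto simp: nw_corner_def p outer_turns_def)
    ultimately show ?thesis by simp
  qed
  have se_term: "displacement \<sigma> (se_corner p) * indicator {I. path_contains \<sigma> I (se_corner p)} I
      = (if p \<in> inner_turns then - gap p else 0)" if "p \<in> se_points" for p
  proof -
    obtain i j where p: "p = (i, j)" by force
    have n: "\<not> northwest_at \<sigma> (i, j)"
      using that not_northwest_and_southeast[OF assms(4,5)] se by (auto simp: p)
    have "displacement \<sigma> (se_corner p) = - gap p"
      unfolding displacement_def se_corner_def corner_point_def p gap_def Let_def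
      using n by (simp add: a_def b_def)
    moreover have "path_contains \<sigma> I (se_corner p) \<longleftrightarrow> p \<in> inner_turns"
      unfolding path_contains_def path by (auto simp: se_corner_def p inner_turns_def)
    ultimately show ?thesis by simp
  qed
  have "(\<Sum>c\<in>outward_corners \<sigma>. displacement \<sigma> c * indicator {I. path_contains \<sigma> I c} I)
    = (\<Sum>p\<in>nw_points \<inter> outer_turns. gap p) - (\<Sum>p\<in>se_points \<inter> inner_turns. gap p)"
    unfolding sum_outward_corners[OF assms(4,5)] nw se
    by (simp add: nw_term se_term sum.inter_restrict[OF fin(1)] sum.inter_restrict[OF fin(2)]
        sum_negf[symmetric] if_distrib[of uminus] cong: if_cong)
  moreover have "2 * K = 1 / real a + 1 / real b" by (simp add: K_def)
  note jag_identity[OF this]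
  ultimately show ?thesis
    unfolding I by (simp add: gap_def case_prod_unfold)
qed

section \<open>Expected jaggedness\<close>

theorem theorem1p2:
  fixes \<sigma> :: skew and a b :: nat and \<mu> :: "box set pmf"
  assumes "skew_shape \<sigma>" and "connected_skew \<sigma>"
    and "a = height \<sigma>" and "b = width \<sigma>"
    and "set_pmf \<mu> \<subseteq> subshapes \<sigma>"
    and "toggle_symmetric (boxes \<sigma>) \<mu>"
  shows "measure_pmf.expectation \<mu> (\<lambda>I. real (jag (boxes \<sigma>) I)) =
    2 * real a * real b / (real a + real b) *
      (1 + (\<Sum>c\<in>outward_corners \<sigma>. displacement \<sigma> c * corner_prob \<sigma> \<mu> c))"
proof -
  define K where "K = (1 / real a + 1 / real b) / 2"
  define w where "w p = 1 - real (fst p) / a - real (snd p) / b + K" for p :: box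
  let ?E = "measure_pmf.expectation \<mu>"
  have "subshapes \<sigma> \<subseteq> Pow (boxes \<sigma>)"
    unfolding subshapes_eq_order_ideals[OF assms(1)] by (auto simp: order_ideals_def)
  then have "finite (set_pmf \<mu>)"
    using assms(5) finite_boxes[OF assms(1)] by (meson finite_Pow_iff finite_subset)
  then have int: "integrable (measure_pmf \<mu>) f" for f :: "box set \<Rightarrow> real"
    by (rule integrable_measure_pmf_finite)
  have "K * ?E (\<lambda>I. real (jag (boxes \<sigma>) I)) = ?E (\<lambda>I. K * real (jag (boxes \<sigma>) I))" by simp
  also have "\<dots> = ?E (\<lambda>I. 1
    + (\<Sum>c\<in>outward_corners \<sigma>. displacement \<sigma> c * indicator {I. path_contains \<sigma> I c} I)
    - (\<Sum>p\<in>boxes \<sigma>. w p * (indicator {I. can_toggle_in (boxes \<sigma>) p I} I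
        - indicator {I. can_toggle_out (boxes \<sigma>) p I} I)))"
  proof (rule integral_cong_AE)
    show "AE I in measure_pmf \<mu>. K * real (jag (boxes \<sigma>) I) = 1
      + (\<Sum>c\<in>outward_corners \<sigma>. displacement \<sigma> c * indicator {I. path_contains \<sigma> I c} I)
      - (\<Sum>p\<in>boxes \<sigma>. w p * (indicator {I. can_toggle_in (boxes \<sigma>) p I} I
        - indicator {I. can_toggle_out (boxes \<sigma>) p I} I))"
    proof (rule AE_pmfI)
      fix I assume "I \<in> set_pmf \<mu>"
      then have "I \<in> subshapes \<sigma>" using assms(5) by blast
      from jag_pointwise[OF assms(1,2) this]
      show "K * real (jag (boxes \<sigma>) I) = 1
        + (\<Sum>c\<in>outward_corners \<sigma>. displacement \<sigma> c * indicator {I. path_contains \<sigma> I c} I)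
        - (\<Sum>p\<in>boxes \<sigma>. w p * (indicator {I. can_toggle_in (boxes \<sigma>) p I} I
          - indicator {I. can_toggle_out (boxes \<sigma>) p I} I))"
        unfolding K_def w_def assms(3,4) .
    qed
  qed auto
  also have "\<dots> = 1 + (\<Sum>c\<in>outward_corners \<sigma>. displacement \<sigma> c * measure_pmf.prob \<mu> {I. path_contains \<sigma> I c})
    - (\<Sum>p\<in>boxes \<sigma>. w p * (measure_pmf.prob \<mu> {I. can_toggle_in (boxes \<sigma>) p I}
        - measure_pmf.prob \<mu> {I. can_toggle_out (boxes \<sigma>) p I}))"
    by (simp add: int Bochner_Integration.integral_sum)
  also have "\<dots> = 1 + (\<Sum>c\<in>outward_corners \<sigma>. displacement \<sigma> c * corner_prob \<sigma> \<mu> c)"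
    using assms(6) by (simp add: toggle_symmetric_def corner_prob_def path_contains_def)
  finally have eq: "K * ?E (\<lambda>I. real (jag (boxes \<sigma>) I)) =
    1 + (\<Sum>c\<in>outward_corners \<sigma>. displacement \<sigma> c * corner_prob \<sigma> \<mu> c)" .
  interpret overlapping_rows "boxes \<sigma>" a b
    "nu_end \<sigma>" "lam_end \<sigma>"
    unfolding assms(3,4) by (rule connected_skew_overlapping_rows[OF assms(1,2)])
  have ab: "real a > 0" "real b > 0" using a_pos b_pos by auto
  then have "K = (real a + real b) / (2 * real a * real b)"
    by (simp add: K_def field_simps)
  then have "2 * real a * real b / (real a + real b) * K = 1"
    using ab by simp
  then show ?thesis
    unfolding eq[symmetric] by (simp only: mult.assoc[symmetric] mult_1)
qed

end
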